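(* Let $(X_n)_{n\ge0}$ be up-down chains on finite pairwise disjoint sets $(\mathbb S_n)_{n\ge0}$ with $\mathbb S_0=\{\varnothing\}$, whose up- and down-steps satisfy $p^\uparrow_np^\downarrow_{n+1}=\beta_np^\downarrow_np^\uparrow_{n-1}+(1-\beta_n)\mathrm{Id}$ for $n\ge1$ with $\beta_n\in(0,1)$, and let $(c_n)_{n\ge0}$ be positive numbers with $c_{n-1}/c_n=\beta_n$ for $n\ge1$. Suppose that for every $n\ge1$ there are $r_n,s_n\in\mathbb S_n$ such that $M_n(s_n)>0$, $n=\min\{m\ge0:p_n^m(r_n,s_n)>0\}$, and $p^\downarrow_{n+1}(r_{n+1},r_n)=1$. Then, with $A_n=c_n(T_n-I)$ and $\Delta^*_k$ the separation distance of the continuous-time process with generator $A_k$, $$\Delta^*_k(t)=\sup_{r\in\mathbb S_n,\ f\in H_k^+}\Big(1-\frac{(e^{tA_n}(f)_n)(r)}{[h_\varnothing]f}\Big),\qquad n\ge k,\ t\ge0.$$ Consequently, $\Delta^*_k(t)$ is nondecreasing in $k$.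
   Context: Here $p^\uparrow_n$ ($n\ge0$), $p^\downarrow_n$ ($n\ge1$) are stochastic matrices from $\mathbb S_n$ to $\mathbb S_{n+1}$, resp. $\mathbb S_{n-1}$; $X_n$ has transition matrix $p_n=p^\uparrow_np^\downarrow_{n+1}$ and transition operator $T_n$; $M_n=(p^\uparrow_0\cdots p^\uparrow_{n-1})(\varnothing,\cdot)$ is its unique stationary distribution. $\mathbb S=\bigcup_n\mathbb S_n$; $|s|$ is the $n$ with $s\in\mathbb S_n$; $c_{-1}=0$; $(f)_n=f|_{\mathbb S_n}$. $$\Delta^*_k(t)=\sup_{r\in\mathbb S_k,\ g:\mathbb S_k\to(0,\infty)}\Big(1-\frac{(e^{tA_k}g)(r)}{\int g\,dM_k}\Big).$$ For $s,u\in\mathbb S$: $d_s(u)=(p^\downarrow_{|u|}\cdots p^\downarrow_{|s|+1})(u,s)$ if $|u|\ge|s|$, and $0$ otherwise. $h_s=\sum_{|r|\le|s|}(p^\uparrow_{|r|}\cdots p^\uparrow_{|s|-1})(r,s)\,\eta_{|r|,|s|}\,d_r$ with $\eta_{i,j}=\prod_{m=i}^{j-1}\frac{c_m}{c_{m-1}-c_{j-1}}$. The functions $(h_s)_{s\in\mathbb S}$ on $\mathbb S$ are linearly independent; $H=\operatorname{span}\{h_s\}_{s\in\mathbb S}$, $H_n=\operatorname{span}\{h_s:|s|\le n\}=\operatorname{span}\{d_s:|s|\le n\}$, $H_n^+=\{f\in H_n:(f)_n>0\text{ on }\mathbb S_n\}$, and $[h_\varnothing]:H\to\mathbb R$ maps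 $\sum_sa_sh_s$ to $a_\varnothing$ (it satisfies $[h_\varnothing]f=\int(f)_n\,dM_n$ for $f\in H_n$). *)

theory Defs
  imports "HOL-Analysis.Analysis" "HOL-Library.Function_Algebras"
begin

text \<open>Matrices are functions \<open>'a \<Rightarrow> 'a \<Rightarrow> real\<close>; only the entries indexed by the relevant finite
  carrier sets matter.\<close>

definition mat_id :: "'a \<Rightarrow> 'a \<Rightarrow> real" where
  "mat_id x y = (if x = y then 1 else 0)"

text \<open>\<open>B\<close> is the set indexing the columns of \<open>P\<close> and the rows of \<open>Q\<close>.\<close>

definition mat_mul :: "'a set \<Rightarrow> ('a \<Rightarrow> 'a \<Rightarrow> real) \<Rightarrow> ('a \<Rightarrow> 'a \<Rightarrow> real) \<Rightarrow> 'a \<Rightarrow> 'a \<Rightarrow> real" where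
  "mat_mul B P Q x z = (\<Sum>y\<in>B. P x y * Q y z)"

primrec mat_pow :: "'a set \<Rightarrow> ('a \<Rightarrow> 'a \<Rightarrow> real) \<Rightarrow> nat \<Rightarrow> 'a \<Rightarrow> 'a \<Rightarrow> real" where
  "mat_pow B P 0 = mat_id"
| "mat_pow B P (Suc m) = mat_mul B (mat_pow B P m) P"

definition stochastic_mat :: "'a set \<Rightarrow> 'a set \<Rightarrow> ('a \<Rightarrow> 'a \<Rightarrow> real) \<Rightarrow> bool" where
  "stochastic_mat A B P \<longleftrightarrow>
     (\<forall>x\<in>A. (\<forall>y\<in>B. P x y \<ge> 0) \<and> (\<Sum>y\<in>B. P x y) = 1)"

text \<open>The exponential series of \<open>t *\<^sub>R L\<close>, evaluated pointwise. It converges when \<open>L\<close> is a linear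
  operator on the functions on a finite set.\<close>

definition exp_op :: "real \<Rightarrow> (('a \<Rightarrow> real) \<Rightarrow> ('a \<Rightarrow> real)) \<Rightarrow> ('a \<Rightarrow> real) \<Rightarrow> 'a \<Rightarrow> real" where
  "exp_op t L f x = (\<Sum>m. t ^ m / fact m * (L ^^ m) f x)"

interpretation fun_vs: vector_space "\<lambda>(a::real) (f::'a \<Rightarrow> real) x. a * f x"
  by unfold_locales (auto simp: fun_eq_iff algebra_simps)

locale up_down_chain =
  fixes S :: "nat \<Rightarrow> 'a set"
    and emp :: 'a
    and p_up p_down :: "nat \<Rightarrow> 'a \<Rightarrow> 'a \<Rightarrow> real"
    and \<beta> c :: "nat \<Rightarrow> real"
  assumes finite_S: "finite (S n)"
    and disjoint_S: "disjoint_family S"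
    and S_0: "S 0 = {emp}"
    and stochastic_up: "stochastic_mat (S n) (S (n + 1)) (p_up n)"
    and stochastic_down: "n \<ge> 1 \<Longrightarrow> stochastic_mat (S n) (S (n - 1)) (p_down n)"
    and \<beta>_range: "n \<ge> 1 \<Longrightarrow> \<beta> n \<in> {0<..<1}"
    and commutation: "\<lbrakk>n \<ge> 1; x \<in> S n; y \<in> S n\<rbrakk> \<Longrightarrow>
      mat_mul (S (n + 1)) (p_up n) (p_down (n + 1)) x y =
        \<beta> n * mat_mul (S (n - 1)) (p_down n) (p_up (n - 1)) x y + (1 - \<beta> n) * mat_id x y"
    and c_pos: "c n > 0"
    and c_ratio: "n \<ge> 1 \<Longrightarrow> c (n - 1) / c n = \<beta> n"
begin

definition states :: "'a set" where
  "states = (\<Union>n. S n)"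

definition rank :: "'a \<Rightarrow> nat" where
  "rank s = (THE n. s \<in> S n)"

definition p :: "nat \<Rightarrow> 'a \<Rightarrow> 'a \<Rightarrow> real" where
  "p n = mat_mul (S (n + 1)) (p_up n) (p_down (n + 1))"

text \<open>The product of the \<open>k\<close> up-steps from level \<open>i\<close> to level \<open>i + k\<close>.\<close>

primrec up_prod :: "nat \<Rightarrow> nat \<Rightarrow> 'a \<Rightarrow> 'a \<Rightarrow> real" where
  "up_prod i 0 = mat_id"
| "up_prod i (Suc k) = mat_mul (S (i + k)) (up_prod i k) (p_up (i + k))"

text \<open>The product of the \<open>k\<close> down-steps from level \<open>j\<close> to level \<open>j - k\<close>, for \<open>k \<le> j\<close>.\<close>

primrec down_prod :: "nat \<Rightarrow> nat \<Rightarrow> 'a \<Rightarrow> 'a \<Rightarrow> real" where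
  "down_prod j 0 = mat_id"
| "down_prod j (Suc k) = mat_mul (S (j - k)) (down_prod j k) (p_down (j - k))"

definition M :: "nat \<Rightarrow> 'a \<Rightarrow> real" where
  "M n = up_prod 0 n emp"

text \<open>Functions on \<open>S n\<close> are extensional functions on \<open>'a\<close>.\<close>

definition T :: "nat \<Rightarrow> ('a \<Rightarrow> real) \<Rightarrow> 'a \<Rightarrow> real" where
  "T n f = (\<lambda>x\<in>S n. \<Sum>y\<in>S n. p n x y * f y)"

definition A :: "nat \<Rightarrow> ('a \<Rightarrow> real) \<Rightarrow> 'a \<Rightarrow> real" where
  "A n f = (\<lambda>x\<in>S n. c n * (T n f x - f x))"

text \<open>For \<open>t \<ge> 0\<close> the supremum is taken over a nonempty set of reals that is bounded above by 1,
  since \<open>exp_op t (A k)\<close> preserves nonnegativity.\<close>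

definition sep :: "nat \<Rightarrow> real \<Rightarrow> real" where
  "sep k t = (SUP (r, g) \<in> S k \<times> (S k \<rightarrow>\<^sub>E {0<..}).
     1 - exp_op t (A k) g r / (\<Sum>x\<in>S k. g x * M k x))"

text \<open>Functions on \<open>states\<close> are extended by 0 to \<open>'a\<close>.\<close>

definition d :: "'a \<Rightarrow> 'a \<Rightarrow> real" where
  "d s u = (if u \<in> states \<and> rank s \<le> rank u then down_prod (rank u) (rank u - rank s) u s else 0)"

text \<open>The value of \<open>c\<close> at \<open>m - 1\<close>, with \<open>c\<^sub>-\<^sub>1 = 0\<close>.\<close>

definition c_prev :: "nat \<Rightarrow> real" where
  "c_prev m = (if m = 0 then 0 else c (m - 1))"

text \<open>The factors have \<open>m < j\<close>, so \<open>c_prev m < c (j - 1)\<close> and no denominator vanishes.\<close>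

definition \<eta> :: "nat \<Rightarrow> nat \<Rightarrow> real" where
  "\<eta> i j = (\<Prod>m\<in>{i..<j}. c m / (c_prev m - c (j - 1)))"

definition h :: "'a \<Rightarrow> 'a \<Rightarrow> real" where
  "h s u = (\<Sum>r\<in>(\<Union>i\<le>rank s. S i).
     up_prod (rank r) (rank s - rank r) r s * \<eta> (rank r) (rank s) * d r u)"

definition H :: "nat \<Rightarrow> ('a \<Rightarrow> real) set" where
  "H n = fun_vs.span (h ` (\<Union>i\<le>n. S i))"

definition H_pos :: "nat \<Rightarrow> ('a \<Rightarrow> real) set" where
  "H_pos n = {f \<in> H n. \<forall>x\<in>S n. f x > 0}"

text \<open>The coefficient of \<open>h emp\<close> in the expansion of \<open>f\<close> in the basis \<open>h ` states\<close>. This is a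
  basis of the space of linear combinations of all the \<open>h s\<close>, and \<open>h\<close> is injective on \<open>states\<close>:
  \<open>h s\<close> is \<open>d s\<close> plus a combination of \<open>d r\<close> with \<open>rank r < rank s\<close>, while \<open>d s\<close> is 1 at \<open>s\<close>
  and vanishes at all other \<open>u\<close> with \<open>rank u \<le> rank s\<close>.\<close>

definition h_emp_coeff :: "('a \<Rightarrow> real) \<Rightarrow> real" where
  "h_emp_coeff f = fun_vs.representation (h ` states) f (h emp)"

end

end

theory Submission
  imports Defs
begin

text \<open>The functions of \<open>H k\<close> are determined by their values on \<open>S k\<close>, since their values on each
  higher level are down-step averages of those on the level below, and the down-steps intertwine the
  semigroups of successive levels. So for \<open>n \<ge> k\<close> the right-hand supremum runs over averages of the
  ratios defining \<open>sep k\<close>, and at \<open>r n\<close>, from which the down-steps lead to \<open>r k\<close> with probability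
  one, it still sees the ratios at \<open>r k\<close>. It remains to see that the extreme ratio is attained at
  \<open>r k\<close>, by the indicator of \<open>s k\<close>. By the commutation relation, \<open>A (n + 1)\<close> is \<open>c n\<close> times
  (down-step composed with up-step, minus the identity), so that the
  semigroup \<open>E n t = exp_op t (A n)\<close> satisfies
  \<open>d/dt E (n + 1) t f = c n * (down n (E n t (up n f)) - E (n + 1) t f)\<close>; this propagates the
  comparison from level \<open>n\<close> to level \<open>n + 1\<close>, as the distance condition on \<open>r n\<close>, \<open>s n\<close> is inherited
  by all predecessors of \<open>s n\<close>.\<close>

section \<open>A differential inequality, and suprema approached in the limit\<close>

text \<open>The integrating factor \<open>exp (c * t)\<close> makes the product with
  \<open>g\<close> nondecreasing for \<open>t \<ge> 0\<close>. It is meant for derivatives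
  \<open>c * (k t - g t)\<close> with \<open>k t \<ge> 0\<close>.\<close>

lemma nonneg_if_deriv_plus_nonneg:
  fixes g g' :: "real \<Rightarrow> real"
  assumes "\<And>t. (g has_real_derivative g' t) (at t)"
    and "\<And>t. t \<ge> 0 \<Longrightarrow> g' t + c * g t \<ge> 0"
    and "g 0 \<ge> 0" "t \<ge> 0"
  shows "g t \<ge> 0"
proof -
  have der: "((\<lambda>t. exp (c * t) * g t) has_real_derivative exp (c * x) * (g' x + c * g x)) (at x)" for x
    by (auto intro!: derivative_eq_intros assms(1) simp: algebra_simps)
  have "exp (c * 0) * g 0 \<le> exp (c * t) * g t"
    by (rule DERIV_nonneg_imp_nondecreasing[OF assms(4)])
       (use der assms(2) in \<open>meson mult_nonneg_nonneg exp_ge_zero\<close>)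
  then have "0 \<le> exp (c * t) * g t"
    using assms(3) by simp
  then show ?thesis
    by (simp add: zero_le_mult_iff)
qed

text \<open>For suprema that need not be attained: members \<open>\<psi> \<epsilon>\<close> of the
  family approach the upper bound \<open>a\<close> as \<open>\<epsilon>\<close> decreases to
  0.\<close>

lemma cSUP_eq_limit:
  fixes \<phi> :: "'i \<Rightarrow> real"
  assumes "\<And>i. i \<in> I \<Longrightarrow> \<phi> i \<le> a"
    and "(\<psi> \<longlongrightarrow> a) (at_right (0::real))"
    and "\<And>\<epsilon>. \<epsilon> > 0 \<Longrightarrow> \<psi> \<epsilon> \<in> \<phi> ` I"
  shows "(SUP i\<in>I. \<phi> i) = a"
proof (rule cSup_eq_non_empty)
  show "\<phi> ` I \<noteq> {}"
    using assms(3)[of 1] by auto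
  show "x \<le> a" if "x \<in> \<phi> ` I" for x
    using that assms(1) by auto
  show "a \<le> y" if "\<And>x. x \<in> \<phi> ` I \<Longrightarrow> x \<le> y" for y
  proof (rule tendsto_upperbound[OF assms(2)])
    show "\<forall>\<^sub>F \<epsilon> in at_right 0. \<psi> \<epsilon> \<le> y"
      using that assms(3) by (auto simp: eventually_at_right_less intro!: eventually_at_rightI[of 0 1])
  qed simp
qed

lemma sum_fun_apply: "(\<Sum>i\<in>I. F i) x = (\<Sum>i\<in>I. F i x)"
  for F :: "'i \<Rightarrow> 'b \<Rightarrow> real"
  by (induction I rule: infinite_finite_induct) auto

section \<open>Averaging operators along down- and up-steps\<close>

context up_down_chain
begin

text \<open>On functions the directions reverse: \<open>down n\<close> lifts functions from
  \<open>S n\<close> to \<open>S (Suc n)\<close>, and \<open>up n\<close> goes back. Both are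
  indexed by the lower level.\<close>

definition down :: "nat \<Rightarrow> ('a \<Rightarrow> real) \<Rightarrow> 'a \<Rightarrow> real" where
  "down n f x = (\<Sum>y\<in>S n. p_down (Suc n) x y * f y)"

definition up :: "nat \<Rightarrow> ('a \<Rightarrow> real) \<Rightarrow> 'a \<Rightarrow> real" where
  "up n f x = (\<Sum>y\<in>S (Suc n). p_up n x y * f y)"

definition mean :: "nat \<Rightarrow> ('a \<Rightarrow> real) \<Rightarrow> real" where
  "mean n f = (\<Sum>x\<in>S n. f x * M n x)"

abbreviation E :: "nat \<Rightarrow> real \<Rightarrow> ('a \<Rightarrow> real) \<Rightarrow> 'a \<Rightarrow> real" where
  "E n t \<equiv> exp_op t (A n)"

lemma p_up_nonneg: "x \<in> S n \<Longrightarrow> y \<in> S (Suc n) \<Longrightarrow> p_up n x y \<ge> 0"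
  using stochastic_up[of n] by (auto simp: stochastic_mat_def)

lemma p_up_sum: "x \<in> S n \<Longrightarrow> (\<Sum>y\<in>S (Suc n). p_up n x y) = 1"
  using stochastic_up[of n] by (auto simp: stochastic_mat_def)

lemma p_down_nonneg: "x \<in> S (Suc n) \<Longrightarrow> y \<in> S n \<Longrightarrow> p_down (Suc n) x y \<ge> 0"
  using stochastic_down[of "Suc n"] by (auto simp: stochastic_mat_def)

lemma p_down_sum: "x \<in> S (Suc n) \<Longrightarrow> (\<Sum>y\<in>S n. p_down (Suc n) x y) = 1"
  using stochastic_down[of "Suc n"] by (auto simp: stochastic_mat_def)

lemma down_cong: "(\<And>y. y \<in> S n \<Longrightarrow> f y = g y) \<Longrightarrow> down n f x = down n g x"
  by (simp add: down_def)

lemma up_cong: "(\<And>y. y \<in> S (Suc n) \<Longrightarrow> f y = g y) \<Longrightarrow> up n f x = up n g x"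
  by (simp add: up_def)

lemma down_mono:
  "x \<in> S (Suc n) \<Longrightarrow> (\<And>y. y \<in> S n \<Longrightarrow> f y \<le> g y) \<Longrightarrow> down n f x \<le> down n g x"
  by (auto simp: down_def intro!: sum_mono mult_left_mono p_down_nonneg)

lemma up_mono:
  "x \<in> S n \<Longrightarrow> (\<And>y. y \<in> S (Suc n) \<Longrightarrow> f y \<le> g y) \<Longrightarrow> up n f x \<le> up n g x"
  by (auto simp: up_def intro!: sum_mono mult_left_mono p_up_nonneg)

lemma down_const: "x \<in> S (Suc n) \<Longrightarrow> down n (\<lambda>_. a) x = a"
  by (simp add: down_def p_down_sum flip: sum_distrib_right)

lemma up_const: "x \<in> S n \<Longrightarrow> up n (\<lambda>_. a) x = a"
  by (simp add: up_def p_up_sum flip: sum_distrib_right)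

lemma down_lincomb:
  "down n (\<lambda>x. a * f x + b * g x) = (\<lambda>x. a * down n f x + b * down n g x)"
  by (simp add: down_def algebra_simps sum.distrib sum_distrib_left fun_eq_iff)

lemma up_lincomb:
  "up n (\<lambda>x. a * f x + b * g x) = (\<lambda>x. a * up n f x + b * up n g x)"
  by (simp add: up_def algebra_simps sum.distrib sum_distrib_left fun_eq_iff)

lemma down_nonneg: "x \<in> S (Suc n) \<Longrightarrow> (\<And>y. y \<in> S n \<Longrightarrow> f y \<ge> 0) \<Longrightarrow> down n f x \<ge> 0"
  using down_mono[of x n "\<lambda>_. 0" f] by (simp add: down_const)

lemma up_nonneg: "x \<in> S n \<Longrightarrow> (\<And>y. y \<in> S (Suc n) \<Longrightarrow> f y \<ge> 0) \<Longrightarrow> up n f x \<ge> 0"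
  using up_mono[of x n "\<lambda>_. 0" f] by (simp add: up_const)

lemma down_bound:
  assumes "x \<in> S (Suc n)" "\<And>y. y \<in> S n \<Longrightarrow> \<bar>f y\<bar> \<le> B"
  shows "\<bar>down n f x\<bar> \<le> B"
  using down_mono[of x n f "\<lambda>_. B"] down_mono[of x n "\<lambda>_. - B" f] assms
  by (force simp: down_const abs_le_iff)

lemma up_bound:
  assumes "x \<in> S n" "\<And>y. y \<in> S (Suc n) \<Longrightarrow> \<bar>f y\<bar> \<le> B"
  shows "\<bar>up n f x\<bar> \<le> B"
  using up_mono[of x n f "\<lambda>_. B"] up_mono[of x n "\<lambda>_. - B" f] assms
  by (force simp: up_const abs_le_iff)

lemma down_pos:
  assumes x: "x \<in> S (Suc n)" and f: "\<And>y. y \<in> S n \<Longrightarrow> f y > 0"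
  shows "down n f x > 0"
proof -
  have "S n \<noteq> {}"
    using p_down_sum[OF x] by auto
  then have "down n (\<lambda>_. Min (f ` S n)) x \<le> down n f x" "Min (f ` S n) > 0"
    using f finite_S by (auto intro!: down_mono x)
  then show ?thesis
    using x by (simp add: down_const)
qed

text \<open>A stochastic row with an entry one vanishes elsewhere, so averaging becomes evaluation
  at \<open>z\<close>.\<close>

lemma down_concentrated:
  assumes x: "x \<in> S (Suc n)" and z: "z \<in> S n" and "p_down (Suc n) x z = 1"
  shows "down n f x = f z"
proof -
  have "(\<Sum>y\<in>S n - {z}. p_down (Suc n) x y) = 0"
    using p_down_sum[OF x] assms(3) finite_S z by (simp add: sum_diff1)
  then have "\<forall>y\<in>S n - {z}. p_down (Suc n) x y = 0"
    using finite_S p_down_nonneg[OF x] by (subst (asm) sum_nonneg_eq_0_iff) auto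
  then have "down n f x = (\<Sum>y\<in>{z}. p_down (Suc n) x y * f y)"
    unfolding down_def using finite_S z by (intro sum.mono_neutral_right) auto
  then show ?thesis
    using assms(3) by simp
qed

lemma T_eq: "x \<in> S n \<Longrightarrow> T n f x = up n (down n f) x"
  unfolding T_def p_def mat_mul_def up_def down_def
  by (simp add: sum_distrib_left sum_distrib_right mult.assoc) (rule sum.swap)

lemma T_Suc_eq:
  assumes x: "x \<in> S (Suc n)"
  shows "T (Suc n) f x = \<beta> (Suc n) * down n (up n f) x + (1 - \<beta> (Suc n)) * f x"
proof -
  have "T (Suc n) f x = (\<Sum>y\<in>S (Suc n). (\<beta> (Suc n) * mat_mul (S n) (p_down (Suc n)) (p_up n) x y
      + (1 - \<beta> (Suc n)) * mat_id x y) * f y)"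
    unfolding T_def p_def using commutation[of "Suc n" x] x by simp
  also have "\<dots> = \<beta> (Suc n) * (\<Sum>y\<in>S (Suc n). mat_mul (S n) (p_down (Suc n)) (p_up n) x y * f y)
      + (1 - \<beta> (Suc n)) * (\<Sum>y\<in>S (Suc n). mat_id x y * f y)"
    by (simp add: algebra_simps sum.distrib sum_distrib_left sum_subtractf)
  also have "(\<Sum>y\<in>S (Suc n). mat_id x y * f y) = (\<Sum>y\<in>S (Suc n). if x = y then f y else 0)"
    by (intro sum.cong) (auto simp: mat_id_def)
  also have "\<dots> = f x"
    using x finite_S by simp
  also have "(\<Sum>y\<in>S (Suc n). mat_mul (S n) (p_down (Suc n)) (p_up n) x y * f y) = down n (up n f) x"
    unfolding mat_mul_def up_def down_def
    by (simp add: sum_distrib_left sum_distrib_right mult.assoc) (rule sum.swap)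
  finally show ?thesis .
qed

lemma A_eq: "x \<in> S n \<Longrightarrow> A n f x = c n * (up n (down n f) x - f x)"
  by (simp add: A_def T_eq)

text \<open>Subtracting the identity from the commutation relation leaves
  \<open>\<beta> (Suc n)\<close> times down-up minus identity, and
  \<open>c (Suc n) * \<beta> (Suc n) = c n\<close>.\<close>

lemma A_Suc_eq:
  assumes x: "x \<in> S (Suc n)"
  shows "A (Suc n) f x = c n * (down n (up n f) x - f x)"
proof -
  have "c n = c (Suc n) * \<beta> (Suc n)"
    using c_ratio[of "Suc n"] c_pos[of "Suc n"] by (simp add: field_simps)
  then show ?thesis
    using x by (simp add: A_def T_Suc_eq algebra_simps)
qed

lemma A_cong:
  assumes "x \<in> S n" "\<And>y. y \<in> S n \<Longrightarrow> f y = g y"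
  shows "A n f x = A n g x"
proof -
  have "down n f = down n g"
    using assms(2) by (intro ext down_cong)
  then show ?thesis
    using assms by (simp add: A_eq)
qed

lemma A_lincomb:
  "x \<in> S n \<Longrightarrow> A n (\<lambda>x. a * f x + b * g x) x = a * A n f x + b * A n g x"
  by (simp add: A_eq down_lincomb up_lincomb algebra_simps)

text \<open>\<open>A n\<close> and \<open>A (Suc n)\<close> carry the same factor
  \<open>c n\<close>, one with up-down and the other with down-up; both sides are \<open>c n\<close>
  times down-up-down minus down.\<close>

lemma A_down:
  assumes "x \<in> S (Suc n)"
  shows "A (Suc n) (down n f) x = down n (A n f) x"
proof -
  have "down n (A n f) x = down n (\<lambda>x. c n * up n (down n f) x + (- c n) * f x) x"
    by (rule down_cong) (simp add: A_eq algebra_simps)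
  then show ?thesis
    using assms by (simp only: A_Suc_eq down_lincomb) (simp add: algebra_simps)
qed

lemma A_bound:
  assumes "x \<in> S n" "\<And>y. y \<in> S n \<Longrightarrow> \<bar>f y\<bar> \<le> B"
  shows "\<bar>A n f x\<bar> \<le> 2 * c n * B"
proof -
  have "\<bar>up n (down n f) x - f x\<bar> \<le> 2 * B"
    using up_bound[of x n "down n f" B] down_bound[of _ n f B] assms by force
  then have "c n * \<bar>up n (down n f) x - f x\<bar> \<le> c n * (2 * B)"
    using c_pos[of n] by (intro mult_left_mono) auto
  then show ?thesis
    using assms c_pos[of n] by (simp add: A_eq abs_mult)
qed

lemma A_funpow_cong:
  "x \<in> S n \<Longrightarrow> (\<And>y. y \<in> S n \<Longrightarrow> f y = g y) \<Longrightarrow> (A n ^^ m) f x = (A n ^^ m) g x"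
  by (induction m arbitrary: x) (auto intro!: A_cong)

lemma A_funpow_lincomb:
  "x \<in> S n \<Longrightarrow>
    (A n ^^ m) (\<lambda>x. a * f x + b * g x) x = a * (A n ^^ m) f x + b * (A n ^^ m) g x"
proof (induction m arbitrary: x)
  case (Suc m)
  have "(A n ^^ Suc m) (\<lambda>x. a * f x + b * g x) x
      = A n (\<lambda>x. a * (A n ^^ m) f x + b * (A n ^^ m) g x) x"
    using Suc by (auto intro!: A_cong)
  then show ?case
    using Suc.prems by (simp add: A_lincomb)
qed simp

lemma A_funpow_down:
  "x \<in> S (Suc n) \<Longrightarrow> (A (Suc n) ^^ m) (down n f) x = down n ((A n ^^ m) f) x"
proof (induction m arbitrary: x)
  case (Suc m)
  then have "(A (Suc n) ^^ Suc m) (down n f) x = A (Suc n) (down n ((A n ^^ m) f)) x"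
    by (auto intro!: A_cong)
  then show ?case
    using Suc.prems by (simp add: A_down)
qed simp

lemma A_funpow_bound:
  assumes "\<And>y. y \<in> S n \<Longrightarrow> \<bar>f y\<bar> \<le> B"
  shows "x \<in> S n \<Longrightarrow> \<bar>(A n ^^ m) f x\<bar> \<le> (2 * c n) ^ m * B"
proof (induction m arbitrary: x)
  case (Suc m)
  then show ?case
    using A_bound[OF Suc.prems, of "(A n ^^ m) f" "(2 * c n) ^ m * B"]
    by (simp add: algebra_simps)
qed (use assms in auto)

section \<open>The semigroups \<open>E n t\<close>\<close>

text \<open>\<open>A n\<close> has sup norm at most \<open>2 * c n\<close>, so an exponential series
  dominates. The terms are written as coefficient times \<open>t ^ m\<close> for differentiation in
  \<open>t\<close>.\<close>

lemma E_summable_coeff: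
  assumes x: "x \<in> S n"
  shows "summable (\<lambda>m. (A n ^^ m) f x / fact m * t ^ m)"
proof (rule summable_comparison_test')
  let ?B = "\<Sum>y\<in>S n. \<bar>f y\<bar>"
  show "summable (\<lambda>m. ?B * (inverse (fact m) * (2 * c n * \<bar>t\<bar>) ^ m))"
    by (intro summable_mult summable_exp)
  show "norm ((A n ^^ m) f x / fact m * t ^ m) \<le> ?B * (inverse (fact m) * (2 * c n * \<bar>t\<bar>) ^ m)" for m
  proof -
    have "\<bar>(A n ^^ m) f x\<bar> \<le> (2 * c n) ^ m * ?B"
      using finite_S by (intro A_funpow_bound x member_le_sum) auto
    then have "\<bar>(A n ^^ m) f x\<bar> * (\<bar>t\<bar> ^ m / fact m) \<le> (2 * c n) ^ m * ?B * (\<bar>t\<bar> ^ m / fact m)"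
      by (intro mult_right_mono) auto
    then show ?thesis
      by (simp add: abs_mult power_abs power_mult_distrib field_simps)
  qed
qed

lemma E_summable: "x \<in> S n \<Longrightarrow> summable (\<lambda>m. t ^ m / fact m * (A n ^^ m) f x)"
  using E_summable_coeff[of x n f t] by (simp add: field_simps)

lemma E_cong: "x \<in> S n \<Longrightarrow> (\<And>y. y \<in> S n \<Longrightarrow> f y = g y) \<Longrightarrow> E n t f x = E n t g x"
  using A_funpow_cong[of x n f g] by (simp add: exp_op_def)

lemma E_lincomb:
  assumes x: "x \<in> S n"
  shows "E n t (\<lambda>x. a * f x + b * g x) x = a * E n t f x + b * E n t g x"
proof -
  have "(\<lambda>m. a * (t ^ m / fact m * (A n ^^ m) f x) + b * (t ^ m / fact m * (A n ^^ m) g x))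
      sums (a * E n t f x + b * E n t g x)"
    unfolding exp_op_def by (intro sums_add sums_mult summable_sums E_summable x)
  then show ?thesis
    by (subst (1) exp_op_def) (simp add: A_funpow_lincomb[OF x] algebra_simps sums_iff)
qed

lemma E_sum:
  assumes x: "x \<in> S n"
  shows "finite I \<Longrightarrow> E n t (\<lambda>x. \<Sum>i\<in>I. a i * F i x) x = (\<Sum>i\<in>I. a i * E n t (F i) x)"
proof (induction I rule: finite_induct)
  case empty
  show ?case
    using E_lincomb[OF x, of t 0 "\<lambda>_. 0" 0 "\<lambda>_. 0"] by simp
next
  case (insert i I)
  then show ?case
    using E_lincomb[OF x, of t "a i" "F i" 1 "\<lambda>x. \<Sum>i\<in>I. a i * F i x"] by simp
qed

lemma E_zero_time: "E n 0 f x = f x"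
  using powser_zero[of "\<lambda>m. (A n ^^ m) f x / fact m"] by (simp add: exp_op_def field_simps)

lemma E_down:
  assumes "x \<in> S (Suc n)"
  shows "E (Suc n) t (down n f) x = down n (E n t f) x"
proof -
  have "E (Suc n) t (down n f) x
      = (\<Sum>m. \<Sum>y\<in>S n. p_down (Suc n) x y * (t ^ m / fact m * (A n ^^ m) f y))"
    using assms by (simp add: exp_op_def A_funpow_down down_def sum_distrib_left algebra_simps)
  also have "\<dots> = (\<Sum>y\<in>S n. \<Sum>m. p_down (Suc n) x y * (t ^ m / fact m * (A n ^^ m) f y))"
    by (intro suminf_sum summable_mult E_summable)
  also have "\<dots> = (\<Sum>y\<in>S n. p_down (Suc n) x y * (\<Sum>m. t ^ m / fact m * (A n ^^ m) f y))"
    by (intro sum.cong refl suminf_mult E_summable)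
  finally show ?thesis
    by (simp add: down_def exp_op_def)
qed

lemma E_has_derivative:
  assumes x: "x \<in> S n"
  shows "((\<lambda>t. E n t f x) has_real_derivative E n t (A n f) x) (at t)"
proof -
  define a where "a m = (A n ^^ m) f x / fact m" for m
  have "diffs a m = (A n ^^ m) (A n f) x / fact m" for m
    by (simp add: diffs_def a_def funpow_swap1 field_simps del: of_nat_Suc)
  then have "E n t (A n f) x = (\<Sum>m. diffs a m * t ^ m)"
    by (simp add: exp_op_def mult.commute)
  moreover have "(\<lambda>t. E n t f x) = (\<lambda>t. \<Sum>m. a m * t ^ m)"
    by (simp add: exp_op_def a_def field_simps)
  moreover have "summable (\<lambda>m. a m * y ^ m)" for y
    using E_summable_coeff[OF x] by (simp add: a_def)
  ultimately show ?thesis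
    using termdiffs_strong_converges_everywhere[of a t] by simp
qed

text \<open>The recursion over levels: \<open>A_Suc_eq\<close> is applied to the initial function,
  and \<open>E_down\<close> turns the semigroup of level \<open>Suc n\<close> on a lifted function
  into that of level \<open>n\<close>.\<close>

lemma E_has_derivative_Suc:
  assumes x: "x \<in> S (Suc n)"
  shows "((\<lambda>t. E (Suc n) t f x) has_real_derivative
    c n * (down n (E n t (up n f)) x - E (Suc n) t f x)) (at t)"
proof -
  have "E (Suc n) t (A (Suc n) f) x
      = E (Suc n) t (\<lambda>x. c n * down n (up n f) x + (- c n) * f x) x"
    by (rule E_cong[OF x]) (simp add: A_Suc_eq algebra_simps)
  then show ?thesis
    using E_has_derivative[OF x, of f t]
    by (simp only: E_lincomb[OF x] E_down[OF x]) (simp add: algebra_simps)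
qed

lemma E_0: "E 0 t f emp = f emp"
proof -
  \<comment> \<open>Since \<open>S 0\<close> is a single point, the down-step from level 1 is
    deterministic and the chain on level 0 stands still.\<close>
  have A0: "A 0 g emp = 0" for g
  proof -
    have "up 0 (down 0 g) emp = up 0 (\<lambda>_. g emp) emp"
      by (rule up_cong, rule down_concentrated) (use S_0 p_down_sum[of _ 0] in auto)
    then show ?thesis
      by (simp add: A_eq S_0 up_const)
  qed
  have "(A 0 ^^ m) f emp = (if m = 0 then f emp else 0)" for m
    using A0 by (cases m) auto
  then have "E 0 t f emp = (\<Sum>m\<in>{0}. t ^ m / fact m * (A 0 ^^ m) f emp)"
    unfolding exp_op_def by (intro suminf_finite) auto
  then show ?thesis
    by simp
qed

text \<open>By \<open>E_has_derivative_Suc\<close>, the derivative plus \<open>c n\<close> times the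
  value is \<open>c n\<close> times an average of \<open>E n t (up n f)\<close>, nonnegative by
  induction on the level.\<close>

lemma E_nonneg:
  "x \<in> S n \<Longrightarrow> (\<And>y. y \<in> S n \<Longrightarrow> f y \<ge> 0) \<Longrightarrow> t \<ge> 0 \<Longrightarrow> E n t f x \<ge> 0"
proof (induction n arbitrary: x f t)
  case 0
  then show ?case
    using S_0 by (auto simp: E_0)
next
  case (Suc n)
  show ?case
    by (rule nonneg_if_deriv_plus_nonneg[where c = "c n", OF E_has_derivative_Suc])
       (use Suc c_pos[of n] in \<open>auto simp: E_zero_time algebra_simps
          intro!: mult_nonneg_nonneg down_nonneg Suc.IH up_nonneg\<close>)
qed

section \<open>The distributions \<open>M n\<close> and their integrals\<close>

lemma M_0: "M 0 emp = 1"
  by (simp add: M_def mat_id_def)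

lemma M_Suc: "M (Suc n) y = (\<Sum>x\<in>S n. M n x * p_up n x y)"
  by (simp add: M_def mat_mul_def)

lemma M_nonneg: "x \<in> S n \<Longrightarrow> M n x \<ge> 0"
  by (induction n arbitrary: x)
     (auto simp: S_0 M_0 M_Suc intro!: sum_nonneg mult_nonneg_nonneg p_up_nonneg)

lemma mean_up: "mean n (up n f) = mean (Suc n) f"
  unfolding mean_def up_def M_Suc
  by (simp add: sum_distrib_left sum_distrib_right algebra_simps) (rule sum.swap)

lemma mean_cong: "(\<And>x. x \<in> S n \<Longrightarrow> f x = g x) \<Longrightarrow> mean n f = mean n g"
  by (simp add: mean_def)

lemma mean_lincomb: "mean n (\<lambda>x. a * f x + b * g x) = a * mean n f + b * mean n g"
  by (simp add: mean_def algebra_simps sum.distrib sum_distrib_left)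

lemma mean_nonneg: "(\<And>x. x \<in> S n \<Longrightarrow> f x \<ge> 0) \<Longrightarrow> mean n f \<ge> 0"
  unfolding mean_def by (intro sum_nonneg mult_nonneg_nonneg M_nonneg)

lemma mean_pos:
  assumes "\<And>x. x \<in> S n \<Longrightarrow> f x > 0" "y \<in> S n" "M n y > 0"
  shows "mean n f > 0"
  unfolding mean_def using assms finite_S
  by (intro sum_pos2[of _ y]) (auto intro!: mult_nonneg_nonneg M_nonneg simp: less_imp_le)

lemma mean_indicator: "y \<in> S n \<Longrightarrow> mean n (mat_id y) = M n y"
  by (simp add: mean_def mat_id_def finite_S if_distrib[of "\<lambda>a. a * _"] cong: if_cong)

text \<open>\<open>mean_up\<close> moves the integral one level down, where the commutation relation
  turns up-down into a mixture of \<open>down n (up n f)\<close> and \<open>f\<close>; both have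
  mean \<open>mean (Suc n) f\<close>, the first by induction.\<close>

lemma mean_down: "mean (Suc n) (down n f) = mean n f"
proof (induction n arbitrary: f)
  case 0
  have "mean (Suc 0) (down 0 f) = mean 0 (up 0 (down 0 f))"
    by (simp add: mean_up)
  moreover have "up 0 (down 0 f) emp = up 0 (\<lambda>_. f emp) emp"
    by (rule up_cong, rule down_concentrated) (use S_0 p_down_sum[of _ 0] in auto)
  ultimately show ?case
    by (simp add: mean_def S_0 up_const)
next
  case (Suc n)
  let ?b = "\<beta> (Suc n)"
  have "mean (Suc (Suc n)) (down (Suc n) f) = mean (Suc n) (up (Suc n) (down (Suc n) f))"
    by (simp add: mean_up)
  also have "\<dots> = mean (Suc n) (\<lambda>x. ?b * down n (up n f) x + (1 - ?b) * f x)"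
    by (rule mean_cong) (simp add: T_Suc_eq flip: T_eq)
  also have "\<dots> = mean (Suc n) f"
    unfolding mean_lincomb Suc.IH mean_up by (simp add: algebra_simps)
  finally show ?case .
qed

section \<open>Powers of the transition operators and the distance condition\<close>

lemma T_mono:
  "x \<in> S n \<Longrightarrow> (\<And>y. y \<in> S n \<Longrightarrow> f y \<le> g y) \<Longrightarrow> T n f x \<le> T n g x"
  by (simp add: T_eq up_mono down_mono)

lemma T_funpow_nonneg:
  "x \<in> S n \<Longrightarrow> (\<And>y. y \<in> S n \<Longrightarrow> f y \<ge> 0) \<Longrightarrow> (T n ^^ m) f x \<ge> 0"
  by (induction m arbitrary: x) (auto simp: T_eq intro!: up_nonneg down_nonneg)

lemma T_funpow_eq_mat_pow:
  "x \<in> S n \<Longrightarrow> (T n ^^ m) f x = (\<Sum>y\<in>S n. mat_pow (S n) (p n) m x y * f y)"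
proof (induction m arbitrary: f)
  case 0
  have "(\<Sum>y\<in>S n. mat_id x y * f y) = (\<Sum>y\<in>S n. if x = y then f y else 0)"
    by (intro sum.cong) (auto simp: mat_id_def)
  then show ?case
    using 0 finite_S by simp
next
  case (Suc m)
  have "(T n ^^ Suc m) f x = (T n ^^ m) (T n f) x"
    by (simp add: funpow_swap1)
  also have "\<dots> = (\<Sum>y\<in>S n. mat_pow (S n) (p n) m x y * (\<Sum>z\<in>S n. p n y z * f z))"
    by (subst Suc.IH[OF Suc.prems]) (simp add: T_def)
  also have "\<dots> = (\<Sum>z\<in>S n. mat_pow (S n) (p n) (Suc m) x z * f z)"
    by (simp add: mat_mul_def sum_distrib_left sum_distrib_right mult.assoc) (rule sum.swap)
  finally show ?case .
qed

text \<open>The chain on level \<open>n\<close> cannot lead from \<open>x\<close> to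
  \<open>y\<close> in fewer than \<open>n\<close> steps, with matrix powers replaced by powers of
  \<open>T n\<close> on an indicator.\<close>

definition far :: "nat \<Rightarrow> 'a \<Rightarrow> 'a \<Rightarrow> bool" where
  "far n x y \<longleftrightarrow> (\<forall>m<n. (T n ^^ m) (mat_id y) x = 0)"

lemma mat_pow_eq_T_funpow:
  assumes "x \<in> S n" "y \<in> S n"
  shows "mat_pow (S n) (p n) m x y = (T n ^^ m) (mat_id y) x"
  using assms
  by (simp add: T_funpow_eq_mat_pow finite_S mat_id_def if_distrib[of "\<lambda>a. _ * a"] cong: if_cong)

text \<open>On nonnegative functions \<open>T (Suc n)\<close> is at least
  \<open>\<beta> (Suc n)\<close> times down-up. In powers of this bound each inner up-down is a
  \<open>T n\<close>.\<close>

lemma T_funpow_Suc_ge: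
  assumes f: "\<And>y. y \<in> S (Suc n) \<Longrightarrow> f y \<ge> 0"
  shows "x \<in> S (Suc n) \<Longrightarrow>
    \<beta> (Suc n) ^ Suc m * down n ((T n ^^ m) (up n f)) x \<le> (T (Suc n) ^^ Suc m) f x"
proof (induction m arbitrary: x)
  case 0
  then show ?case
    using f \<beta>_range[of "Suc n"] by (simp add: T_Suc_eq)
next
  case (Suc m)
  let ?b = "\<beta> (Suc n)"
  let ?g = "(T n ^^ m) (up n f)"
  have b: "0 < ?b" "?b < 1"
    using \<beta>_range[of "Suc n"] by auto
  have nonneg: "(T (Suc n) ^^ Suc m) f y \<ge> 0" if "y \<in> S (Suc n)" for y
    using that f by (rule T_funpow_nonneg)
  have "?b ^ Suc m * T n ?g y \<le> up n ((T (Suc n) ^^ Suc m) f) y" if y: "y \<in> S n" for y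
  proof -
    have "?b ^ Suc m * T n ?g y = up n (\<lambda>x. ?b ^ Suc m * down n ?g x) y"
      using up_lincomb[of n "?b ^ Suc m" "down n ?g" 0 "\<lambda>_. 0"] y by (simp add: T_eq)
    also have "\<dots> \<le> up n ((T (Suc n) ^^ Suc m) f) y"
      using y Suc.IH by (rule up_mono)
    finally show ?thesis .
  qed
  then have "down n (\<lambda>y. ?b ^ Suc m * T n ?g y) x
      \<le> down n (up n ((T (Suc n) ^^ Suc m) f)) x"
    using Suc.prems by (intro down_mono)
  then have "?b ^ Suc m * down n (T n ?g) x \<le> down n (up n ((T (Suc n) ^^ Suc m) f)) x"
    using down_lincomb[of n "?b ^ Suc m" "T n ?g" 0 "\<lambda>_. 0"] by simp
  then have "?b * (?b ^ Suc m * down n (T n ?g) x)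
      \<le> ?b * down n (up n ((T (Suc n) ^^ Suc m) f)) x"
    using b by (intro mult_left_mono) auto
  \<comment> \<open>Drops the nonnegative term with factor
    \<open>1 - \<beta> (Suc n)\<close>.\<close>
  also have "\<dots> \<le> T (Suc n) ((T (Suc n) ^^ Suc m) f) x"
    using nonneg[OF Suc.prems] b Suc.prems by (simp add: T_Suc_eq)
  finally show ?case
    by simp
qed

lemma far_0: "far 0 x y"
  by (simp add: far_def)

lemma far_Suc_imp_neq: "far (Suc n) x y \<Longrightarrow> x \<noteq> y"
  by (auto simp: far_def mat_id_def)

text \<open>Stepping from \<open>x\<close> down to \<open>x'\<close>, making \<open>m\<close> steps
  on level \<open>n\<close> to \<open>z\<close> and stepping up to \<open>y\<close> costs only
  \<open>m + 1\<close> steps on level \<open>Suc n\<close>, by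
  \<open>T_funpow_Suc_ge\<close>.\<close>

lemma far_Suc_imp_far:
  assumes far: "far (Suc n) x y" and xy: "x \<in> S (Suc n)" "y \<in> S (Suc n)"
    and x': "x' \<in> S n" "p_down (Suc n) x x' = 1"
    and z: "z \<in> S n" "p_up n z y > 0"
  shows "far n x' z"
  unfolding far_def
proof (intro allI impI)
  fix m assume "m < n"
  \<comment> \<open>\<open>up n (mat_id y) w\<close> is \<open>p_up n w y\<close>; only its value at
    \<open>w = z\<close> is kept.\<close>
  have up_ge: "p_up n z y * mat_id z w \<le> up n (mat_id y) w" if "w \<in> S n" for w
    using that xy z p_up_nonneg[of w n y] finite_S[of "Suc n"]
    by (auto simp: up_def mat_id_def if_distrib[of "\<lambda>a. _ * a"] cong: if_cong)
  have "p_up n z y * (T n ^^ m) (mat_id z) w \<le> (T n ^^ m) (up n (mat_id y)) w" if "w \<in> S n" for w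
    using that
  proof (induction m arbitrary: w)
    case (Suc m)
    have "p_up n z y * T n ((T n ^^ m) (mat_id z)) w = T n (\<lambda>w. p_up n z y * (T n ^^ m) (mat_id z) w) w"
      using Suc.prems by (simp add: T_def sum_distrib_left algebra_simps)
    also have "\<dots> \<le> T n ((T n ^^ m) (up n (mat_id y))) w"
      using Suc by (intro T_mono)
    finally show ?case
      by simp
  qed (use up_ge in simp)
  then have "p_up n z y * (T n ^^ m) (mat_id z) x' \<le> down n ((T n ^^ m) (up n (mat_id y))) x"
    using x' xy by (simp add: down_concentrated)
  moreover have "\<beta> (Suc n) ^ Suc m * down n ((T n ^^ m) (up n (mat_id y))) x \<le> 0"
    using T_funpow_Suc_ge[OF _ xy(1), of "mat_id y" m] far \<open>m < n\<close>
    by (simp add: far_def mat_id_def del: funpow.simps power_Suc)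
  moreover have "\<beta> (Suc n) ^ Suc m > 0"
    using \<beta>_range[of "Suc n"] by simp
  ultimately have "p_up n z y * (T n ^^ m) (mat_id z) x' \<le> 0"
    by (meson mult_pos_pos not_le order_trans)
  then have "(T n ^^ m) (mat_id z) x' \<le> 0"
    using z(2) by (simp add: mult_le_0_iff)
  moreover have "(T n ^^ m) (mat_id z) x' \<ge> 0"
    by (rule T_funpow_nonneg[OF x'(1)]) (simp add: mat_id_def)
  ultimately show "(T n ^^ m) (mat_id z) x' = 0"
    by simp
qed

section \<open>Comparison of ratios by induction on the level\<close>

text \<open>The ratio comparison is cross-multiplied because \<open>M n y\<close> may be zero. It is
  stated for all \<open>y\<close> far from \<open>\<rho> n\<close>, since the induction passes to
  predecessors of the target.\<close>

lemma E_mat_id_times_mean_le: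
  assumes \<rho>: "\<And>n. \<rho> n \<in> S n" "\<And>n. p_down (Suc n) (\<rho> (Suc n)) (\<rho> n) = 1"
  shows "y \<in> S n \<Longrightarrow> far n (\<rho> n) y \<Longrightarrow> x \<in> S n \<Longrightarrow> (\<And>w. w \<in> S n \<Longrightarrow> g w \<ge> 0) \<Longrightarrow> t \<ge> 0 \<Longrightarrow>
    E n t (mat_id y) (\<rho> n) * mean n g \<le> E n t g x * M n y"
proof (induction n arbitrary: x y g t)
  case 0
  have "\<rho> 0 = emp" "x = emp" "y = emp"
    using 0 \<rho>(1)[of 0] S_0 by auto
  then show ?case
    by (simp add: E_0 mean_def S_0 M_0 mat_id_def)
next
  case (Suc n)
  note x = \<open>x \<in> S (Suc n)\<close> and y = \<open>y \<in> S (Suc n)\<close>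
  let ?r = "\<rho> (Suc n)" and ?m = "mean (Suc n) g" and ?M = "M (Suc n) y"
  \<comment> \<open>\<open>G\<close> is the difference of the two sides. \<open>K\<close> replaces
    its semigroup terms by the level-\<open>n\<close> terms of \<open>E_has_derivative_Suc\<close>,
    so \<open>G\<close> has derivative \<open>c n * (K t - G t)\<close>; at
    \<open>\<rho> (Suc n)\<close> the down average is evaluation at \<open>\<rho> n\<close>.\<close>
  define G where "G t = E (Suc n) t g x * ?M - E (Suc n) t (mat_id y) ?r * ?m" for t
  define K where "K t = down n (E n t (up n g)) x * ?M - E n t (up n (mat_id y)) (\<rho> n) * ?m" for t
  have "G t \<ge> 0"
  proof (rule nonneg_if_deriv_plus_nonneg[of G "\<lambda>t. c n * (K t - G t)" "c n"])
    show "(G has_real_derivative c n * (K t - G t)) (at t)" for t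
      unfolding G_def
      by (auto intro!: derivative_eq_intros E_has_derivative_Suc x \<rho>
          simp: K_def down_concentrated[OF \<rho>(1) \<rho>(1) \<rho>(2)] algebra_simps)
    show "c n * (K t - G t) + c n * G t \<ge> 0" if t: "t \<ge> 0" for t
    proof -
      let ?I = "E n t (up n (mat_id y)) (\<rho> n) * ?m"
      \<comment> \<open>\<open>up n (mat_id y)\<close> is the column of \<open>p_up n\<close> at
        \<open>y\<close>, a combination of indicators on level \<open>n\<close>.\<close>
      have I_eq: "?I = (\<Sum>z\<in>S n. p_up n z y * (E n t (mat_id z) (\<rho> n) * mean n (up n g)))"
      proof -
        have "E n t (up n (mat_id y)) (\<rho> n) = E n t (\<lambda>w. \<Sum>z\<in>S n. p_up n z y * mat_id z w) (\<rho> n)"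
          using y finite_S
          by (intro E_cong \<rho>)
             (auto simp: up_def mat_id_def if_distrib[of "\<lambda>a. _ * a"] cong: if_cong)
        also have "\<dots> = (\<Sum>z\<in>S n. p_up n z y * E n t (mat_id z) (\<rho> n))"
          by (intro E_sum \<rho> finite_S)
        finally show ?thesis
          by (simp add: mean_up sum_distrib_right mult.assoc)
      qed
      \<comment> \<open>Sum the induction hypothesis over \<open>z\<close> with weights
        \<open>p_up n z y\<close>. States of positive weight are far from \<open>\<rho> n\<close> by
        \<open>far_Suc_imp_far\<close>, and the weighted sum of the \<open>M n z\<close> is
        \<open>?M\<close>.\<close>
      have "?I \<le> E n t (up n g) w * ?M" if w: "w \<in> S n" for w
      proof -
        have "?I \<le> (\<Sum>z\<in>S n. p_up n z y * (E n t (up n g) w * M n z))"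
          unfolding I_eq
        proof (rule sum_mono)
          fix z assume z: "z \<in> S n"
          show "p_up n z y * (E n t (mat_id z) (\<rho> n) * mean n (up n g))
              \<le> p_up n z y * (E n t (up n g) w * M n z)"
          proof (cases "p_up n z y = 0")
            case False
            then have p: "p_up n z y > 0"
              using p_up_nonneg[OF z y] by simp
            have "far n (\<rho> n) z"
              by (rule far_Suc_imp_far[OF Suc.prems(2) \<rho>(1) y \<rho> z p])
            then show ?thesis
              using z w t p Suc.prems(4) by (intro mult_left_mono Suc.IH up_nonneg) auto
          qed simp
        qed
        also have "\<dots> = E n t (up n g) w * ?M"
          by (simp add: M_Suc sum_distrib_left algebra_simps)
        finally show ?thesis .
      qed
      then have "down n (\<lambda>_. ?I) x \<le> down n (\<lambda>w. ?M * E n t (up n g) w) x"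
        using x by (intro down_mono) (auto simp: mult.commute)
      then have "?I \<le> down n (E n t (up n g)) x * ?M"
        using x down_lincomb[of n ?M "E n t (up n g)" 0 "\<lambda>_. 0"]
        by (simp add: down_const mult.commute)
      then have "c n * K t \<ge> 0"
        using c_pos[of n] by (simp add: K_def)
      then show ?thesis
        by (simp add: algebra_simps)
    qed
    \<comment> \<open>The distance condition at time zero: \<open>y\<close> differs from
      \<open>\<rho> (Suc n)\<close>, so the subtracted term vanishes.\<close>
    show "G 0 \<ge> 0"
      using far_Suc_imp_neq[OF Suc.prems(2)] Suc.prems(4)[OF x] M_nonneg[OF y]
      by (simp add: G_def E_zero_time mat_id_def)
  qed (rule \<open>t \<ge> 0\<close>)
  then show ?case
    by (simp add: G_def)
qed

section \<open>Levels and the functions \<open>d s\<close> and \<open>h s\<close>\<close>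

definition states_upto :: "nat \<Rightarrow> 'a set" where
  "states_upto n = (\<Union>i\<le>n. S i)"

lemma finite_upto: "finite (states_upto n)"
  by (simp add: states_upto_def finite_S)

lemma upto_mono: "m \<le> n \<Longrightarrow> states_upto m \<subseteq> states_upto n"
  by (force simp: states_upto_def)

lemma states_eq: "states = (\<Union>n. states_upto n)"
  by (auto simp: states_def states_upto_def)

lemma rank_eq: "x \<in> S n \<Longrightarrow> rank x = n"
  unfolding rank_def
  by (rule the_equality) (use disjoint_S in \<open>auto simp: disjoint_family_on_def\<close>)

lemma in_upto_iff: "x \<in> states_upto n \<longleftrightarrow> x \<in> states \<and> rank x \<le> n"
  by (auto simp: states_upto_def states_def rank_eq)

lemma states_rank: "x \<in> states \<Longrightarrow> x \<in> S (rank x)"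
  by (auto simp: states_def rank_eq)

lemma sum_upto: "(\<Sum>x\<in>states_upto n. F x) = (\<Sum>i\<le>n. \<Sum>x\<in>S i. F x)" for F :: "'a \<Rightarrow> real"
  unfolding states_upto_def using disjoint_S
  by (intro sum.UNION_disjoint) (auto simp: finite_S disjoint_family_on_def)

lemma sum_mat_id_right: "x \<in> S n \<Longrightarrow> (\<Sum>y\<in>S n. F y * mat_id y x) = F x"
  by (simp add: mat_id_def finite_S if_distrib[of "\<lambda>a. _ * a"] cong: if_cong)

lemma sum_mat_id_left: "x \<in> S n \<Longrightarrow> (\<Sum>y\<in>S n. mat_id x y * F y) = F x"
  by (simp add: mat_id_def finite_S if_distrib[of "\<lambda>a. a * _"] cong: if_cong)

text \<open>\<open>down_prod\<close> appends its steps at the lower end; splitting off the first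
  step instead gives a recursion in the upper level.\<close>

lemma down_prod_Suc_left:
  "x \<in> S (Suc n) \<Longrightarrow> k \<le> n \<Longrightarrow> z \<in> S (n - k) \<Longrightarrow>
    down_prod (Suc n) (Suc k) x z = (\<Sum>y\<in>S n. p_down (Suc n) x y * down_prod n k y z)"
proof (induction k arbitrary: z)
  case 0
  then show ?case
    by (simp add: mat_mul_def sum_mat_id_left sum_mat_id_right)
next
  case (Suc k)
  have Sk: "Suc n - Suc k = n - k"
    by simp
  have "down_prod (Suc n) (Suc (Suc k)) x z
      = (\<Sum>w\<in>S (n - k). down_prod (Suc n) (Suc k) x w * p_down (n - k) w z)"
    by (simp add: mat_mul_def)
  also have "\<dots> = (\<Sum>w\<in>S (n - k).
      (\<Sum>y\<in>S n. p_down (Suc n) x y * down_prod n k y w) * p_down (n - k) w z)"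
    using Suc by (simp del: down_prod.simps)
  also have "\<dots> = (\<Sum>y\<in>S n. p_down (Suc n) x y * down_prod n (Suc k) y z)"
    by (simp add: mat_mul_def sum_distrib_left sum_distrib_right mult.assoc) (rule sum.swap)
  finally show ?case .
qed

lemma d_same: "s \<in> S n \<Longrightarrow> u \<in> S n \<Longrightarrow> d s u = mat_id u s"
  by (auto simp: d_def rank_eq states_def)

lemma d_below: "s \<in> S m \<Longrightarrow> u \<in> S n \<Longrightarrow> n < m \<Longrightarrow> d s u = 0"
  by (auto simp: d_def rank_eq)

lemma d_Suc:
  assumes s: "s \<in> S m" and "m \<le> n" and u: "u \<in> S (Suc n)"
  shows "d s u = down n (d s) u"
proof -
  have *: "d s v = down_prod l (l - m) v s" if "v \<in> S l" "m \<le> l" for v l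
    using s that by (auto simp: d_def rank_eq states_def)
  have "d s u = down_prod (Suc n) (Suc (n - m)) u s"
    using * u \<open>m \<le> n\<close> by (simp add: Suc_diff_le del: down_prod.simps)
  also have "\<dots> = (\<Sum>y\<in>S n. p_down (Suc n) u y * down_prod n (n - m) y s)"
    by (rule down_prod_Suc_left) (use assms in auto)
  finally show ?thesis
    using * \<open>m \<le> n\<close> by (simp add: down_def)
qed

lemma h_eq: "h s = (\<lambda>u. \<Sum>r\<in>states_upto (rank s).
    up_prod (rank r) (rank s - rank r) r s * \<eta> (rank r) (rank s) * d r u)"
  by (simp add: h_def states_upto_def fun_eq_iff)

lemma h_Suc:
  assumes "s \<in> S m" "m \<le> n" "u \<in> S (Suc n)"
  shows "h s u = down n (h s) u"
proof -
  have "down n (d r) u = d r u" if "r \<in> states_upto (rank s)" for r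
    using that assms by (intro d_Suc[of r "rank r", symmetric]) (auto simp: in_upto_iff states_rank rank_eq)
  then have "h s u = (\<Sum>r\<in>states_upto (rank s).
      up_prod (rank r) (rank s - rank r) r s * \<eta> (rank r) (rank s) * down n (d r) u)"
    by (simp add: h_eq)
  also have "\<dots> = down n (h s) u"
    unfolding h_eq down_def by (simp add: sum_distrib_left algebra_simps) (rule sum.swap)
  finally show ?thesis .
qed

lemma mean_d:
  assumes s: "s \<in> S m" and "m \<le> n"
  shows "mean n (d s) = M m s"
  using \<open>m \<le> n\<close>
proof (induction n rule: dec_induct)
  case base
  show ?case
    using s by (simp add: mean_def d_same mult.commute[of "mat_id _ _"] sum_mat_id_right)
next
  case (step n)
  have "mean (Suc n) (d s) = mean (Suc n) (down n (d s))"
    by (rule mean_cong) (use s step in \<open>auto intro: d_Suc\<close>)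
  then show ?case
    using step by (simp add: mean_down)
qed

lemma M_up_prod: "s \<in> S (i + k) \<Longrightarrow> (\<Sum>r\<in>S i. M i r * up_prod i k r s) = M (i + k) s"
proof (induction k arbitrary: s)
  case (Suc k)
  have "(\<Sum>r\<in>S i. M i r * up_prod i (Suc k) r s)
      = (\<Sum>y\<in>S (i + k). (\<Sum>r\<in>S i. M i r * up_prod i k r y) * p_up (i + k) y s)"
    by (simp add: mat_mul_def sum_distrib_left sum_distrib_right mult.assoc) (rule sum.swap)
  then show ?case
    using Suc.IH by (simp add: M_Suc)
qed (simp add: sum_mat_id_right)

section \<open>Cancellation of the coefficients \<open>\<eta>\<close> and the mean of
  \<open>h s\<close>\<close>

lemma c_mono: "m < n \<Longrightarrow> c m < c n"
proof (rule less_Suc_induct)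
  show "c i < c (Suc i)" for i
    using c_ratio[of "Suc i"] \<beta>_range[of "Suc i"] c_pos[of "Suc i"] by (auto simp: field_simps)
qed auto

lemma \<eta>_refl: "\<eta> j j = 1"
  by (simp add: \<eta>_def)

text \<open>The tail sums telescope to a closed form, which vanishes at \<open>i = 0\<close> because \<open>c\<^sub>-\<^sub>1 = 0\<close>.\<close>

lemma \<eta>_tail_sum:
  assumes "j \<ge> 1"
  shows "i \<le> j \<Longrightarrow> (\<Sum>l=i..j. \<eta> l j) = \<eta> i j * c_prev i / c_prev j"
proof (induction i rule: inc_induct)
  case base
  then show ?case
    using assms c_pos[of "j - 1"] by (simp add: \<eta>_refl c_prev_def)
next
  case (step i)
  have pos: "c (j - 1) > 0" and ne: "c_prev i \<noteq> c (j - 1)"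
  proof -
    show "c (j - 1) > 0"
      by (rule c_pos)
    show "c_prev i \<noteq> c (j - 1)"
    proof (cases "i = 0")
      case True
      then show ?thesis
        using c_pos[of "j - 1"] by (simp add: c_prev_def)
    next
      case False
      then have "i - 1 < j - 1"
        using step.hyps by linarith
      then show ?thesis
        using c_mono[of "i - 1" "j - 1"] False by (simp add: c_prev_def)
    qed
  qed
  have "{i..<j} = insert i {Suc i..<j}"
    using step.hyps by auto
  then have \<eta>_i: "\<eta> i j = c i / (c_prev i - c (j - 1)) * \<eta> (Suc i) j"
    by (simp add: \<eta>_def)
  have "(\<Sum>l=i..j. \<eta> l j) = \<eta> i j + (\<Sum>l=Suc i..j. \<eta> l j)"
    using step.hyps by (simp add: sum.atLeast_Suc_atMost)
  also have "\<dots> = \<eta> i j + \<eta> (Suc i) j * c i / c (j - 1)"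
    using step assms by (simp add: c_prev_def)
  also have "\<eta> (Suc i) j * c i = \<eta> i j * (c_prev i - c (j - 1))"
    using ne by (simp add: \<eta>_i)
  finally show ?case
    using pos assms by (simp add: c_prev_def field_simps)
qed

lemma \<eta>_sum: "j \<ge> 1 \<Longrightarrow> (\<Sum>i\<le>j. \<eta> i j) = 0"
  using \<eta>_tail_sum[of j 0] by (simp add: c_prev_def atMost_atLeast0)

text \<open>Each \<open>d r\<close> of rank \<open>i\<close> has mean \<open>M i r\<close>, and
  weighting with the up-steps to the level \<open>m\<close> of \<open>s\<close> turns this into
  \<open>M m s\<close>. There remains the sum of the \<open>\<eta> i m\<close>, which is zero unless
  \<open>m = 0\<close>.\<close>

lemma mean_h:
  assumes s: "s \<in> states_upto n"
  shows "mean n (h s) = mat_id s emp"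
proof -
  define m where "m = rank s"
  have sm: "s \<in> S m" "m \<le> n"
    using s by (auto simp: m_def in_upto_iff states_rank)
  have "mean n (h s) = (\<Sum>r\<in>states_upto m. up_prod (rank r) (m - rank r) r s * \<eta> (rank r) m * mean n (d r))"
    unfolding h_eq mean_def m_def[symmetric]
    by (simp add: sum_distrib_left sum_distrib_right mult.assoc) (rule sum.swap)
  also have "\<dots> = (\<Sum>i\<le>m. \<Sum>r\<in>S i. \<eta> i m * (M i r * up_prod i (m - i) r s))"
    unfolding sum_upto using sm by (intro sum.cong refl) (simp add: rank_eq mean_d)
  also have "\<dots> = (\<Sum>i\<le>m. \<eta> i m) * M m s"
    using M_up_prod[of s _ "m - _"] sm by (simp add: sum_distrib_right flip: sum_distrib_left)
  also have "\<dots> = mat_id s emp"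
  proof (cases "m = 0")
    case True
    then show ?thesis
      using sm S_0 by (simp add: \<eta>_refl M_0 mat_id_def)
  next
    case False
    then have "s \<noteq> emp"
      using rank_eq[of emp 0] S_0 m_def by auto
    then show ?thesis
      using False \<eta>_sum[of m] by (simp add: mat_id_def)
  qed
  finally show ?thesis .
qed

section \<open>The spaces \<open>H n\<close>\<close>

lemma H_eq: "H n = fun_vs.span (h ` states_upto n)"
  by (simp add: H_def states_upto_def)

lemma H_mono: "m \<le> n \<Longrightarrow> H m \<subseteq> H n"
  unfolding H_eq by (intro fun_vs.span_mono image_mono upto_mono)

lemma H_Suc:
  assumes "f \<in> H k" "k \<le> n" "u \<in> S (Suc n)"
  shows "f u = down n f u"
  using assms(1) unfolding H_eq
proof (induction rule: fun_vs.span_induct_alt)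
  case base
  show ?case
    by (simp add: down_def)
next
  case (step a f g)
  have "f u = down n f u"
    using step(1) assms(2,3) by (auto simp: in_upto_iff intro!: h_Suc states_rank)
  then show ?case
    using step(2) down_lincomb[of n a f 1 g] by (simp add: plus_fun_def)
qed

text \<open>The passage from \<open>d\<close> to \<open>h\<close> is triangular with unit diagonal,
  so strong induction on the level solves for \<open>d s\<close>.\<close>

lemma d_in_H: "s \<in> S j \<Longrightarrow> j \<le> n \<Longrightarrow> d s \<in> H n"
proof (induction j arbitrary: s rule: less_induct)
  case (less j)
  let ?a = "\<lambda>r. up_prod (rank r) (j - rank r) r s * \<eta> (rank r) j"
  have states_upto: "states_upto j = (\<Union>i<j. S i) \<union> S j"
    by (auto simp: states_upto_def order_le_less)
  have "h s u = (\<Sum>r\<in>(\<Union>i<j. S i). ?a r * d r u) + d s u" for u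
  proof -
    have "h s u = (\<Sum>r\<in>states_upto j. ?a r * d r u)"
      using less.prems by (simp add: h_eq rank_eq)
    also have "\<dots> = (\<Sum>r\<in>(\<Union>i<j. S i). ?a r * d r u) + (\<Sum>r\<in>S j. ?a r * d r u)"
      unfolding states_upto
      by (intro sum.union_disjoint) (auto simp: finite_S dest: rank_eq)
    \<comment> \<open>On the top level no up-steps are left and
      \<open>\<eta> j j = 1\<close>.\<close>
    also have "(\<Sum>r\<in>S j. ?a r * d r u) = (\<Sum>r\<in>S j. d r u * mat_id r s)"
      by (intro sum.cong) (auto simp: rank_eq \<eta>_refl)
    also have "\<dots> = d s u"
      using less.prems by (simp add: sum_mat_id_right)
    finally show ?thesis .
  qed
  then have "d s = h s - (\<Sum>r\<in>(\<Union>i<j. S i). (\<lambda>u. ?a r * d r u))"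
    by (simp add: fun_eq_iff sum_fun_apply)
  also have "\<dots> \<in> H n"
    unfolding H_eq
  proof (intro fun_vs.span_diff fun_vs.span_sum fun_vs.span_scale)
    show "h s \<in> fun_vs.span (h ` states_upto n)"
      using less.prems by (intro fun_vs.span_base) (auto simp: states_upto_def)
    show "d r \<in> fun_vs.span (h ` states_upto n)" if "r \<in> (\<Union>i<j. S i)" for r
      using that less by (auto simp: H_eq)
  qed
  finally show ?case .
qed

text \<open>On \<open>S k\<close> the \<open>d s\<close> with \<open>s\<close> in \<open>S k\<close>
  are indicators, so they interpolate any values.\<close>

lemma ex_H_extension: "\<exists>f\<in>H k. \<forall>x\<in>S k. f x = g x"
proof (intro bexI ballI)
  let ?f = "\<Sum>s\<in>S k. (\<lambda>u. g s * d s u)"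
  show "?f \<in> H k"
    unfolding H_eq
    by (intro fun_vs.span_sum fun_vs.span_scale) (simp add: d_in_H flip: H_eq)
  show "?f x = g x" if "x \<in> S k" for x
    using that by (simp add: sum_fun_apply d_same mult.commute[of _ "mat_id _ _"] sum_mat_id_left)
qed

section \<open>Linear independence and the coefficient of \<open>h emp\<close>\<close>

text \<open>Evaluate at \<open>u = s\<close>: terms of smaller rank have zero coefficient by
  induction, and every other \<open>d r\<close> with \<open>r \<noteq> s\<close> vanishes
  there.\<close>

lemma d_lincomb_eq_0:
  assumes zero: "\<And>u. (\<Sum>s\<in>states_upto n. a s * d s u) = 0" and s: "s \<in> states_upto n"
  shows "a s = 0"
  using s
proof (induction "rank s" arbitrary: s rule: less_induct)
  case less
  have s: "s \<in> S (rank s)"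
    using less.prems by (simp add: in_upto_iff states_rank)
  have "a r * d r s = 0" if "r \<in> states_upto n - {s}" for r
  proof (cases "rank r < rank s")
    case True
    then show ?thesis
      using less.hyps[of r] that by simp
  next
    case False
    then show ?thesis
      using that s d_below[of r "rank r" s "rank s"] d_same[of r "rank s" s]
      by (cases "rank r = rank s") (auto simp: in_upto_iff mat_id_def dest: states_rank)
  qed
  then have "(\<Sum>r\<in>states_upto n. a r * d r s) = (\<Sum>r\<in>{s}. a r * d r s)"
    using less.prems by (intro sum.mono_neutral_right finite_upto) auto
  then show ?case
    using zero[of s] d_same[OF s s] by (simp add: mat_id_def)
qed

lemma inj_on_d: "inj_on d (states_upto n)"
proof (rule inj_onI)
  have le: "s = u" if "s \<in> states_upto n" "u \<in> states_upto n" "d s = d u" "rank s \<le> rank u" for s u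
  proof -
    have su: "s \<in> S (rank s)" "u \<in> S (rank u)"
      using that by (auto simp: in_upto_iff states_rank)
    then have "d u s = 1"
      using d_same[of s "rank s" s] that(3) by (simp add: mat_id_def)
    then have "rank s = rank u"
      using d_below[OF su(2,1)] that(4) by fastforce
    then show ?thesis
      using \<open>d u s = 1\<close> d_same[of u "rank u" s] su by (auto simp: mat_id_def split: if_splits)
  qed
  show "s = u" if "s \<in> states_upto n" "u \<in> states_upto n" "d s = d u" for s u
    using le[of s u] le[of u s] that by (cases "rank s \<le> rank u") auto
qed

lemma independent_d: "\<not> fun_vs.dependent (d ` states_upto n)"
proof
  assume "fun_vs.dependent (d ` states_upto n)"
  then obtain a where a: "\<exists>v\<in>d ` states_upto n. a v \<noteq> 0"
    and zero: "(\<Sum>v\<in>d ` states_upto n. (\<lambda>x. a v * v x)) = 0"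
    using fun_vs.dependent_finite[of "d ` states_upto n"] finite_upto by auto
  have "(\<Sum>s\<in>states_upto n. a (d s) * d s u) = 0" for u
  proof -
    have "(\<Sum>s\<in>states_upto n. a (d s) * d s u) = (\<Sum>v\<in>d ` states_upto n. (\<lambda>x. a v * v x)) u"
      by (simp add: sum_fun_apply sum.reindex[OF inj_on_d])
    then show ?thesis
      using zero by simp
  qed
  then show False
    using d_lincomb_eq_0[of "\<lambda>s. a (d s)" n] a by auto
qed

text \<open>The \<open>h s\<close> span the independent \<open>d s\<close> and there are no more of them, so they are
  independent and distinct.\<close>

lemma card_upto_le:
  assumes "finite B" "H n \<subseteq> fun_vs.span B"
  shows "card (states_upto n) \<le> card B"
proof -
  have "d ` states_upto n \<subseteq> H n"
    by (auto simp: states_upto_def intro: d_in_H)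
  then have "card (d ` states_upto n) \<le> card B"
    using fun_vs.independent_span_bound[OF assms(1) independent_d] assms(2) by blast
  then show ?thesis
    by (simp add: card_image inj_on_d)
qed

lemma inj_on_h_upto: "inj_on h (states_upto n)"
proof (rule eq_card_imp_inj_on[OF finite_upto])
  show "card (h ` states_upto n) = card (states_upto n)"
    using card_upto_le[of "h ` states_upto n" n] card_image_le[OF finite_upto, of h n]
    by (simp add: H_eq finite_upto)
qed

lemma independent_h_upto: "\<not> fun_vs.dependent (h ` states_upto n)"
proof
  assume "fun_vs.dependent (h ` states_upto n)"
  then obtain v where v: "v \<in> h ` states_upto n" "v \<in> fun_vs.span (h ` states_upto n - {v})"
    by (auto simp: fun_vs.dependent_def)
  have "H n \<subseteq> fun_vs.span (h ` states_upto n - {v})"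
    unfolding H_eq
    using v by (metis fun_vs.span_redundant insert_Diff subset_refl)
  then have "card (states_upto n) \<le> card (h ` states_upto n - {v})"
    using finite_upto by (intro card_upto_le) auto
  also have "\<dots> < card (h ` states_upto n)"
    using v finite_upto by (intro psubset_card_mono) auto
  also have "\<dots> \<le> card (states_upto n)"
    by (rule card_image_le[OF finite_upto])
  finally show False
    by simp
qed

text \<open>Independence passes to the union of the increasing chain of images of the
  \<open>states_upto n\<close>.\<close>

lemma independent_h: "\<not> fun_vs.dependent (h ` states)"
proof -
  have "h ` states = \<Union> (range (\<lambda>n. h ` states_upto n))"
    by (auto simp: states_eq)
  moreover have "\<not> fun_vs.dependent (\<Union> (range (\<lambda>n. h ` states_upto n)))"
  proof (rule fun_vs.independent_Union_directed)
    show "B \<subseteq> C \<or> C \<subseteq> B"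
      if "B \<in> range (\<lambda>n. h ` states_upto n)" "C \<in> range (\<lambda>n. h ` states_upto n)" for B C
    proof -
      obtain m n where "B = h ` states_upto m" "C = h ` states_upto n"
        using \<open>B \<in> _\<close> \<open>C \<in> _\<close> by blast
      then show ?thesis
        using upto_mono[of m n] upto_mono[of n m] by (metis image_mono nle_le)
    qed
    show "\<not> fun_vs.dependent B" if "B \<in> range (\<lambda>n. h ` states_upto n)" for B
      using that independent_h_upto by auto
  qed
  ultimately show ?thesis
    by simp
qed

text \<open>Both sides are linear on \<open>H k\<close> and agree on the \<open>h s\<close> by
  \<open>mean_h\<close>.\<close>

lemma h_emp_coeff_eq_mean:
  assumes "f \<in> H k"
  shows "h_emp_coeff f = mean k f"
proof -
  \<comment> \<open>Membership is carried along because additivity of the representation is used on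
    the span.\<close>
  have "f \<in> H k \<and> h_emp_coeff f = mean k f"
    using assms unfolding H_eq
  proof (induction rule: fun_vs.span_induct_alt)
    case base
    show ?case
      unfolding h_emp_coeff_def
      by (simp only: fun_vs.span_zero fun_vs.representation_zero) (simp add: mean_def)
  next
    case (step a v f)
    then obtain s where s: "s \<in> states_upto k" "v = h s"
      by auto
    have emp: "emp \<in> states_upto k"
      using S_0 by (auto simp: states_upto_def)
    have sub: "h ` states_upto k \<subseteq> h ` states"
      by (auto simp: states_eq)
    have v: "v \<in> fun_vs.span (h ` states_upto k)" "v \<in> h ` states"
      using step(1) sub by (auto intro: fun_vs.span_base)
    have span: "g \<in> fun_vs.span (h ` states)" if "g \<in> fun_vs.span (h ` states_upto k)" for g
      using that fun_vs.span_mono[OF sub] by auto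
    have "h_emp_coeff v = mean k v"
      using v s inj_onD[OF inj_on_h_upto, of emp s k] emp
      by (auto simp: h_emp_coeff_def fun_vs.representation_basis[OF independent_h] mean_h mat_id_def)
    moreover have "h_emp_coeff ((\<lambda>x. a * v x) + f) = a * h_emp_coeff v + h_emp_coeff f"
      using step(2) span v(1) fun_vs.span_scale[OF span[OF v(1)], of a]
      by (simp add: h_emp_coeff_def fun_vs.representation_add[OF independent_h]
          fun_vs.representation_scale[OF independent_h])
    moreover have "mean k ((\<lambda>x. a * v x) + f) = a * mean k v + mean k f"
      using mean_lincomb[of k a v 1 f] by (simp add: plus_fun_def)
    moreover have "(\<lambda>x. a * v x) + f \<in> fun_vs.span (h ` states_upto k)"
      using step(2) v(1) by (intro fun_vs.span_add fun_vs.span_scale) auto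
    ultimately show ?case
      using step(2) by metis
  qed
  then show ?thesis ..
qed

section \<open>Both suprema as one minus the minimal ratio\<close>

text \<open>By \<open>H_Suc\<close> and \<open>E_down\<close>, the evolution of \<open>f\<close> on
  each higher level averages that on the level below, and lower bounds survive averaging.\<close>

lemma E_ge_H:
  assumes f: "f \<in> H k" and ge: "\<And>w. w \<in> S k \<Longrightarrow> a \<le> E k t f w" and "k \<le> n"
  shows "x \<in> S n \<Longrightarrow> a \<le> E n t f x"
  using \<open>k \<le> n\<close>
proof (induction n arbitrary: x rule: dec_induct)
  case (step n)
  have "E (Suc n) t f x = down n (E n t f) x"
    using E_cong[OF step.prems, of f "down n f"] H_Suc[OF f step.hyps(1)] E_down[OF step.prems]
    by simp
  then show ?case
    using step.IH down_mono[OF step.prems, of "\<lambda>_. a" "E n t f"] down_const[OF step.prems]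
    by simp
qed (rule ge)

text \<open>Along the states \<open>\<rho> n\<close> the same averages are point
  evaluations.\<close>

lemma E_H_concentrated:
  assumes \<rho>: "\<And>n. \<rho> n \<in> S n" "\<And>n. p_down (Suc n) (\<rho> (Suc n)) (\<rho> n) = 1"
    and f: "f \<in> H k" and "k \<le> n"
  shows "E n t f (\<rho> n) = E k t f (\<rho> k)"
  using \<open>k \<le> n\<close>
proof (induction n rule: dec_induct)
  case (step n)
  have "E (Suc n) t f (\<rho> (Suc n)) = down n (E n t f) (\<rho> (Suc n))"
    using E_cong[OF \<rho>(1), of "Suc n" f "down n f"] H_Suc[OF f step.hyps(1)] E_down[OF \<rho>(1)]
    by simp
  then show ?case
    using step.IH by (simp add: down_concentrated[OF \<rho>(1) \<rho>(1) \<rho>(2)])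
qed simp

definition sep_H :: "nat \<Rightarrow> nat \<Rightarrow> real \<Rightarrow> real" where
  "sep_H n k t = (SUP (x, f) \<in> S n \<times> H_pos k.
     1 - E n t (restrict f (S n)) x / h_emp_coeff f)"

context
  fixes \<rho> \<sigma> :: "nat \<Rightarrow> 'a"
  assumes \<rho>: "\<And>n. \<rho> n \<in> S n" "\<And>n. p_down (Suc n) (\<rho> (Suc n)) (\<rho> n) = 1"
    and \<sigma>: "\<And>n. \<sigma> n \<in> S n" "\<And>n. M n (\<sigma> n) > 0"
    and far: "\<And>n. far n (\<rho> n) (\<sigma> n)"
begin

text \<open>The quotient in \<open>sep k t\<close> for the indicator of \<open>\<sigma> k\<close>,
  whose mean is \<open>M k (\<sigma> k)\<close>.\<close>

definition min_ratio :: "nat \<Rightarrow> real \<Rightarrow> real" where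
  "min_ratio k t = E k t (mat_id (\<sigma> k)) (\<rho> k) / M k (\<sigma> k)"

lemma mean_pos_\<sigma>: "(\<And>x. x \<in> S k \<Longrightarrow> f x > 0) \<Longrightarrow> mean k f > 0"
  by (rule mean_pos[OF _ \<sigma>])

lemma min_ratio_le:
  assumes "\<And>x. x \<in> S k \<Longrightarrow> f x > 0" "w \<in> S k" "t \<ge> 0"
  shows "min_ratio k t \<le> E k t f w / mean k f"
  unfolding min_ratio_def
  using E_mat_id_times_mean_le[OF \<rho> \<sigma>(1) far assms(2) _ assms(3), of f] assms(1)
    mean_pos_\<sigma>[of k f] \<sigma>(2)[of k]
  by (simp add: divide_simps less_imp_le)

text \<open>The indicator of \<open>\<sigma> k\<close> attains the minimal ratio but is not positive.\<close>

definition approx :: "nat \<Rightarrow> real \<Rightarrow> 'a \<Rightarrow> real" where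
  "approx k \<epsilon> = (\<lambda>x\<in>S k. mat_id (\<sigma> k) x + \<epsilon>)"

lemma approx_pos: "\<epsilon> > 0 \<Longrightarrow> x \<in> S k \<Longrightarrow> approx k \<epsilon> x > 0"
  by (simp add: approx_def mat_id_def)

text \<open>Numerator and denominator are affine in \<open>\<epsilon>\<close>, and the denominator
  tends to \<open>M k (\<sigma> k) > 0\<close>.\<close>

lemma approx_tendsto:
  "((\<lambda>\<epsilon>. 1 - E k t (approx k \<epsilon>) (\<rho> k) / mean k (approx k \<epsilon>)) \<longlongrightarrow> 1 - min_ratio k t) (at_right 0)"
proof -
  let ?one = "\<lambda>_. 1 :: real"
  have "E k t (approx k \<epsilon>) (\<rho> k) = E k t (mat_id (\<sigma> k)) (\<rho> k) + \<epsilon> * E k t ?one (\<rho> k)" for \<epsilon>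
    using E_cong[OF \<rho>(1), of k "approx k \<epsilon>" "\<lambda>x. 1 * mat_id (\<sigma> k) x + \<epsilon> * 1" t]
      E_lincomb[OF \<rho>(1)[of k], of t 1 "mat_id (\<sigma> k)" \<epsilon> ?one]
    by (simp add: approx_def)
  moreover have "mean k (approx k \<epsilon>) = M k (\<sigma> k) + \<epsilon> * mean k ?one" for \<epsilon>
    using mean_cong[of k "approx k \<epsilon>" "\<lambda>x. 1 * mat_id (\<sigma> k) x + \<epsilon> * 1"]
      mean_lincomb[of k 1 "mat_id (\<sigma> k)" \<epsilon> ?one] mean_indicator[OF \<sigma>(1)]
    by (simp add: approx_def)
  ultimately show ?thesis
    unfolding min_ratio_def using \<sigma>(2)[of k] by (auto intro!: tendsto_eq_intros)
qed

lemma sep_eq_min_ratio: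
  assumes "t \<ge> 0"
  shows "sep k t = 1 - min_ratio k t"
  unfolding sep_def mean_def[symmetric]
proof (rule cSUP_eq_limit[OF _ approx_tendsto])
  show "(case i of (x, g) \<Rightarrow> 1 - E k t g x / mean k g) \<le> 1 - min_ratio k t"
    if "i \<in> S k \<times> (S k \<rightarrow>\<^sub>E {0<..})" for i
    using that assms by (auto intro!: min_ratio_le simp: PiE_iff)
  show "1 - E k t (approx k \<epsilon>) (\<rho> k) / mean k (approx k \<epsilon>)
      \<in> (\<lambda>(x, g). 1 - E k t g x / mean k g) ` (S k \<times> (S k \<rightarrow>\<^sub>E {0<..}))" if "\<epsilon> > 0" for \<epsilon>
    using that \<rho> approx_pos[of \<epsilon> _ k]
    by (intro image_eqI[of _ _ "(\<rho> k, approx k \<epsilon>)"]) (auto simp: approx_def)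
qed

text \<open>Lifting to level \<open>n\<close> averages the values on level \<open>k\<close>, so no
  ratio falls below \<open>min_ratio k t\<close>; at \<open>\<rho> n\<close> the approximating
  ratios at \<open>\<rho> k\<close> reappear.\<close>

lemma sep_H_eq_min_ratio:
  assumes "k \<le> n" "t \<ge> 0"
  shows "sep_H n k t = 1 - min_ratio k t"
  unfolding sep_H_def
proof (rule cSUP_eq_limit[OF _ approx_tendsto])
  show "(case i of (x, f) \<Rightarrow> 1 - E n t (restrict f (S n)) x / h_emp_coeff f) \<le> 1 - min_ratio k t"
    if i_in: "i \<in> S n \<times> H_pos k" for i
  proof -
    obtain x f where i: "i = (x, f)" and x: "x \<in> S n"
      and f: "f \<in> H k" "\<And>y. y \<in> S k \<Longrightarrow> f y > 0"
      using i_in by (auto simp: H_pos_def)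
    have m: "mean k f > 0"
      using f(2) by (rule mean_pos_\<sigma>)
    have "min_ratio k t * mean k f \<le> E k t f w" if "w \<in> S k" for w
      using min_ratio_le[of k f w t, OF f(2) that assms(2)] m by (simp add: field_simps)
    then have "min_ratio k t * mean k f \<le> E n t f x"
      using E_ge_H[OF f(1) _ assms(1) x] by blast
    moreover have "E n t (restrict f (S n)) x = E n t f x"
      by (rule E_cong[OF x]) simp
    ultimately show ?thesis
      using m by (simp add: i h_emp_coeff_eq_mean[OF f(1)] field_simps)
  qed
  show "1 - E k t (approx k \<epsilon>) (\<rho> k) / mean k (approx k \<epsilon>)
      \<in> (\<lambda>(x, f). 1 - E n t (restrict f (S n)) x / h_emp_coeff f) ` (S n \<times> H_pos k)"
    if "\<epsilon> > 0" for \<epsilon>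
  proof -
    obtain f where f: "f \<in> H k" "\<And>x. x \<in> S k \<Longrightarrow> f x = approx k \<epsilon> x"
      using ex_H_extension by blast
    have "E n t (restrict f (S n)) (\<rho> n) = E n t f (\<rho> n)"
      by (rule E_cong[OF \<rho>(1)]) simp
    also have "\<dots> = E k t f (\<rho> k)"
      by (rule E_H_concentrated[OF \<rho> f(1) assms(1)])
    also have "\<dots> = E k t (approx k \<epsilon>) (\<rho> k)"
      by (rule E_cong[OF \<rho>(1) f(2)])
    finally have "E n t (restrict f (S n)) (\<rho> n) = E k t (approx k \<epsilon>) (\<rho> k)" .
    moreover have "mean k f = mean k (approx k \<epsilon>)"
      by (rule mean_cong[OF f(2)])
    moreover have "f \<in> H_pos k"
      using f approx_pos[OF that, of _ k] by (auto simp: H_pos_def)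
    ultimately show ?thesis
      using \<rho>(1)[of n] f(1)
      by (intro image_eqI[of _ _ "(\<rho> n, f)"]) (auto simp: h_emp_coeff_eq_mean)
  qed
qed

text \<open>On the common level \<open>Suc k\<close> only the sets of test functions differ. A
  function in \<open>H k\<close> that is positive on \<open>S k\<close> is positive on
  \<open>S (Suc k)\<close>, being an average there.\<close>

lemma sep_H_mono:
  assumes "t \<ge> 0"
  shows "sep_H (Suc k) k t \<le> sep_H (Suc k) (Suc k) t"
  unfolding sep_H_def
proof (rule cSUP_subset_mono)
  show "S (Suc k) \<times> H_pos k \<noteq> {}"
  proof -
    obtain f where "f \<in> H k" "\<forall>x\<in>S k. f x = 1"
      using ex_H_extension[of k "\<lambda>_. 1"] by blast
    then have "f \<in> H_pos k"
      by (auto simp: H_pos_def)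
    then show ?thesis
      using \<rho>(1) by blast
  qed
  show "S (Suc k) \<times> H_pos k \<subseteq> S (Suc k) \<times> H_pos (Suc k)"
    using H_mono[of k "Suc k"] by (auto simp: H_pos_def H_Suc[of _ k k] intro!: down_pos)
  \<comment> \<open>Nonnegativity of the semigroup bounds every member of the family by 1.\<close>
  show "bdd_above ((\<lambda>(x, f). 1 - E (Suc k) t (restrict f (S (Suc k))) x / h_emp_coeff f) `
      (S (Suc k) \<times> H_pos (Suc k)))"
  proof (rule bdd_aboveI2)
    show "(case i of (x, f) \<Rightarrow> 1 - E (Suc k) t (restrict f (S (Suc k))) x / h_emp_coeff f) \<le> 1"
      if "i \<in> S (Suc k) \<times> H_pos (Suc k)" for i
      using that assms
      by (auto simp: H_pos_def h_emp_coeff_eq_mean less_imp_le intro!: divide_nonneg_nonneg E_nonneg mean_nonneg)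
  qed
qed simp

text \<open>Both \<open>sep k t\<close> and \<open>sep (Suc k) t\<close> are suprema on level
  \<open>Suc k\<close>.\<close>

lemma sep_mono: "t \<ge> 0 \<Longrightarrow> mono (\<lambda>k. sep k t)"
  unfolding mono_iff_le_Suc using sep_H_mono by (simp add: sep_eq_min_ratio sep_H_eq_min_ratio)

end

end

theorem proposition3p23:
  fixes S :: "nat \<Rightarrow> 'a set" and emp :: 'a
    and p_up p_down :: "nat \<Rightarrow> 'a \<Rightarrow> 'a \<Rightarrow> real"
    and \<beta> c :: "nat \<Rightarrow> real"
    and r s :: "nat \<Rightarrow> 'a"
  assumes chain: "up_down_chain S emp p_up p_down \<beta> c"
    and rs_in: "\<And>n. n \<ge> 1 \<Longrightarrow> r n \<in> S n \<and> s n \<in> S n"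
    and M_pos: "\<And>n. n \<ge> 1 \<Longrightarrow> up_down_chain.M S emp p_up n (s n) > 0"
    and path_ex: "\<And>n. n \<ge> 1 \<Longrightarrow>
      \<exists>m. mat_pow (S n) (up_down_chain.p S p_up p_down n) m (r n) (s n) > 0"
    and path_min: "\<And>n. n \<ge> 1 \<Longrightarrow>
      n = (LEAST m. mat_pow (S n) (up_down_chain.p S p_up p_down n) m (r n) (s n) > 0)"
    and down_r: "\<And>n. n \<ge> 1 \<Longrightarrow> p_down (n + 1) (r (n + 1)) (r n) = 1"
  shows "(\<forall>k n t. k \<le> n \<and> t \<ge> 0 \<longrightarrow>
            up_down_chain.sep S emp p_up p_down c k t =
              (SUP (x, f) \<in> S n \<times> up_down_chain.H_pos S p_up p_down c k.
                 1 - exp_op t (up_down_chain.A S p_up p_down c n) (restrict f (S n)) x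
                       / up_down_chain.h_emp_coeff S emp p_up p_down c f)) \<and>
         (\<forall>t\<ge>0. mono (\<lambda>k. up_down_chain.sep S emp p_up p_down c k t))"

proof -
  interpret up_down_chain S emp p_up p_down \<beta> c
    by (rule chain)
  \<comment> \<open>The hypotheses start at level 1; level 0 is filled in with its only state
    \<open>emp\<close>.\<close>
  define \<rho> where "\<rho> n = (if n = 0 then emp else r n)" for n
  define \<sigma> where "\<sigma> n = (if n = 0 then emp else s n)" for n
  have \<rho>_in: "\<rho> n \<in> S n" and \<sigma>_in: "\<sigma> n \<in> S n" for n
    using rs_in S_0 by (auto simp: \<rho>_def \<sigma>_def)
  have \<rho>_down: "p_down (Suc n) (\<rho> (Suc n)) (\<rho> n) = 1" for n
  proof (cases "n = 0")
    case True
    then show ?thesis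
      using p_down_sum[OF \<rho>_in, of 0] S_0 by (simp add: \<rho>_def)
  next
    case False
    then show ?thesis
      using down_r[of n] by (simp add: \<rho>_def)
  qed
  have \<sigma>_pos: "M n (\<sigma> n) > 0" for n
    using M_pos by (auto simp: \<sigma>_def M_0)
  have far: "far n (\<rho> n) (\<sigma> n)" for n
  proof (cases "n = 0")
    case False
    show ?thesis
      unfolding far_def
    proof (intro allI impI)
      fix m assume "m < n"
      \<comment> \<open>Below the least exponent the entry is not positive; being nonnegative, it is
        zero.\<close>
      have "\<not> mat_pow (S n) (p n) m (r n) (s n) > 0"
        using path_min[of n] not_less_Least[of m "\<lambda>m. mat_pow (S n) (p n) m (r n) (s n) > 0"]
          \<open>m < n\<close> False by auto
      moreover have "mat_pow (S n) (p n) m (r n) (s n) = (T n ^^ m) (mat_id (\<sigma> n)) (\<rho> n)"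
        using mat_pow_eq_T_funpow[OF \<rho>_in \<sigma>_in, of n m] False by (simp add: \<rho>_def \<sigma>_def)
      moreover have "(T n ^^ m) (mat_id (\<sigma> n)) (\<rho> n) \<ge> 0"
        by (rule T_funpow_nonneg[OF \<rho>_in]) (simp add: mat_id_def)
      ultimately show "(T n ^^ m) (mat_id (\<sigma> n)) (\<rho> n) = 0"
        by simp
    qed
  qed (simp add: far_0)
  note chain_facts = \<rho>_in \<rho>_down \<sigma>_in \<sigma>_pos far
  show ?thesis
    using sep_eq_min_ratio[OF chain_facts] sep_H_eq_min_ratio[OF chain_facts, unfolded sep_H_def]
      sep_mono[OF chain_facts]
    by simp
qed

end
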